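(* Let $\nu<\kappa$ be regular cardinals with $\nu\ge\omega_1$, and let $\mu<\lambda$ be cardinals with $\mu\ge\kappa$. Assume $\operatorname{cov}(\lambda,\mu^+,\mu^+,\nu)=\lambda$. Suppose $\{c_\xi:\xi<\mu\}\subseteq\mathcal P_\nu\mu$ and $T$ is a stationary subset of $\mathcal P_\kappa\mu$ with $|T|=\mu$ such that for every $z\in T$ the family $\{c_\xi:\xi\in z\}$ is unbounded in $\mathcal P_\nu z$. Then $\mathcal P_\kappa\lambda$ has a $\mu$-nonreflecting stationary subset, i.e. there is a stationary $S\subseteq\mathcal P_\kappa\lambda$ such that $S\cap\mathcal P_\kappa A$ is nonstationary in $\mathcal P_\kappa A$ for every $A$ with $\mu\subseteq A\subseteq\lambda$ and $|A|=\mu$.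
   Context: For a set $X$ and a cardinal $\kappa$, $\mathcal P_\kappa X=\{x\subseteq X:|x|<\kappa\}$, and $[X]^\mu=\{x\subseteq X:|x|=\mu\}$. For $|X|\ge\kappa$ with $\kappa$ regular uncountable, a set $C\subseteq\mathcal P_\kappa X$ is club if it is cofinal under $\subseteq$ and closed under unions of $\subseteq$-increasing chains of length $<\kappa$; a set is stationary in $\mathcal P_\kappa X$ if it meets every club subset of $\mathcal P_\kappa X$, nonstationary otherwise. A family $Y\subseteq\mathcal P_\nu z$ is unbounded in $\mathcal P_\nu z$ if every $x\in\mathcal P_\nu z$ is contained in some $y\in Y$. $\operatorname{cov}(\lambda,\mu^+,\mu^+,\nu)=\lambda$ means: there exist sets $E_\alpha\in[\lambda]^\mu$ ($\alpha<\lambda$) such that for every $B\in[\lambda]^\mu$ there is $a\in\mathcal P_\nu\lambda$ with $B\subseteq\bigcup_{\alpha\in a}E_\alpha$. *)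

theory Defs
  imports Main
begin

unbundle cardinal_syntax

text \<open>
  A cardinal is a relation \<open>r\<close> with \<open>Card_order r\<close>; as a von Neumann ordinal it is the set
  \<open>Field r\<close>, and an ordinal below \<open>r\<close> is \<open>underS r \<delta>\<close> for a unique \<open>\<delta> \<in> Field r\<close>.
\<close>

definition P_less :: "'k rel \<Rightarrow> 'a set \<Rightarrow> 'a set set" where
  "P_less \<kappa> X = {x. x \<subseteq> X \<and> |x| <o \<kappa>}"

definition P_eq :: "'k rel \<Rightarrow> 'a set \<Rightarrow> 'a set set" where
  "P_eq \<mu> X = {x. x \<subseteq> X \<and> |x| =o \<mu>}"

text \<open>
  Chains are sequences \<open>f\<close> of length \<open>underS \<kappa> \<delta>\<close>. The empty chain has to be excluded: otherwise
  every club would contain \<open>{}\<close>.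
\<close>

definition club :: "'k rel \<Rightarrow> 'a set \<Rightarrow> 'a set set \<Rightarrow> bool" where
  "club \<kappa> X C \<longleftrightarrow>
     C \<subseteq> P_less \<kappa> X \<and>
     (\<forall>x \<in> P_less \<kappa> X. \<exists>y \<in> C. x \<subseteq> y) \<and>
     (\<forall>\<delta> \<in> Field \<kappa>. \<forall>f :: 'k \<Rightarrow> 'a set.
        underS \<kappa> \<delta> \<noteq> {} \<and>
        (\<forall>i \<in> underS \<kappa> \<delta>. f i \<in> C) \<and>
        (\<forall>i \<in> underS \<kappa> \<delta>. \<forall>j \<in> underS \<kappa> \<delta>. (i, j) \<in> \<kappa> \<longrightarrow> f i \<subseteq> f j)
        \<longrightarrow> (\<Union>i \<in> underS \<kappa> \<delta>. f i) \<in> C)"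

definition stationary :: "'k rel \<Rightarrow> 'a set \<Rightarrow> 'a set set \<Rightarrow> bool" where
  "stationary \<kappa> X S \<longleftrightarrow> S \<subseteq> P_less \<kappa> X \<and> (\<forall>C. club \<kappa> X C \<longrightarrow> S \<inter> C \<noteq> {})"

definition unbounded_in :: "'n rel \<Rightarrow> 'a set \<Rightarrow> 'a set set \<Rightarrow> bool" where
  "unbounded_in \<nu> z Y \<longleftrightarrow> Y \<subseteq> P_less \<nu> z \<and> (\<forall>x \<in> P_less \<nu> z. \<exists>y \<in> Y. x \<subseteq> y)"

text \<open>The assertion \<open>cov(\<Lambda>, \<mu>\<^sup>+, \<mu>\<^sup>+, \<nu>) = \<Lambda>\<close>.\<close>

definition cov_eq :: "'a rel \<Rightarrow> 'm rel \<Rightarrow> 'n rel \<Rightarrow> bool" where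
  "cov_eq \<Lambda> \<mu> \<nu> \<longleftrightarrow>
     (\<exists>E :: 'a \<Rightarrow> 'a set.
        (\<forall>\<alpha> \<in> Field \<Lambda>. E \<alpha> \<in> P_eq \<mu> (Field \<Lambda>)) \<and>
        (\<forall>B \<in> P_eq \<mu> (Field \<Lambda>). \<exists>a \<in> P_less \<nu> (Field \<Lambda>). B \<subseteq> (\<Union>\<alpha> \<in> a. E \<alpha>)))"

text \<open>
  The cardinal \<open>\<mu>\<close> is a relation on the same type as \<open>\<Lambda>\<close>, so that \<open>Field \<mu>\<close> is a subset
  of \<open>Field \<Lambda>\<close> when \<open>\<mu>\<close> is an initial segment of \<open>\<Lambda>\<close>.
\<close>

definition nonreflecting_stationary :: "'k rel \<Rightarrow> 'a rel \<Rightarrow> 'a rel \<Rightarrow> 'a set set \<Rightarrow> bool" where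
  "nonreflecting_stationary \<kappa> \<mu> \<Lambda> S \<longleftrightarrow>
     stationary \<kappa> (Field \<Lambda>) S \<and>
     (\<forall>A. Field \<mu> \<subseteq> A \<and> A \<subseteq> Field \<Lambda> \<and> |A| =o \<mu> \<longrightarrow>
        \<not> stationary \<kappa> A (S \<inter> P_less \<kappa> A))"

end

theory Submission
  imports Defs "HOL.Hull"
begin

text \<open>
  Write \<open>E[b]\<close> for \<open>\<Union>\<alpha>\<in>b. E \<alpha>\<close>, where \<open>E\<close> witnesses the covering hypothesis, and fix for every
  \<open>B \<subseteq> \<lambda>\<close> of size at most \<open>\<mu>\<close> a map \<open>e B\<close> of \<open>\<mu>\<close> onto a superset of \<open>B\<close>. The nonreflecting set
  consists of the \<open>x\<close> with \<open>z = x \<inter> \<mu> \<in> T\<close> whose \<open>E\<close>-closure \<open>B\<close> is of the form \<open>E[b]\<close> with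
  \<open>b \<in> P\<^sub>\<nu> x\<close> and which are not contained in \<open>e B ` z\<close>.

  Nonreflection: let \<open>m\<close> be a bijection from \<open>\<mu>\<close> to \<open>A\<close>. For club many \<open>x \<in> P\<^sub>\<kappa> A\<close> we have
  \<open>x = m[z]\<close>, so \<open>b\<close> is contained in some \<open>m[c \<xi>]\<close> with \<open>\<xi> \<in> z\<close>, whence \<open>E[b] = E[m[c \<xi>]]\<close> and, for
  club many \<open>x\<close>, this set contains \<open>A\<close>. So \<open>B\<close> is the \<open>E\<close>-closure of \<open>A\<close>, which does not depend
  on \<open>x\<close>, and then \<open>x \<subseteq> e B ` z\<close> for club many \<open>x\<close>.

  Stationarity: given a club, consider for \<open>z \<in> T\<close> the game of length \<open>\<omega>\<close> in which the opponent names
  sets \<open>G\<close> of size at most \<open>\<mu>\<close> and we extend \<open>b \<in> P\<^sub>\<nu> \<lambda>\<close> so that \<open>G \<subseteq> E[b]\<close>, keeping the trace on \<open>\<mu>\<close>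
  of the hull of \<open>z \<union> b\<close> equal to \<open>z\<close>. As \<open>|T| = \<mu>\<close>, the opponent cannot win for all \<open>z \<in> T\<close>: playing
  against all the winning strategies at once, we reach some \<open>b\<close>, and a club of \<open>z\<close> survives this play.
  For a good \<open>z\<close> we interleave \<open>\<kappa>\<close> many plays so that all of them end with the same \<open>B = E[b]\<close>. The
  resulting hulls have union of size at least \<open>\<kappa> > |z|\<close>, so one of them is not inside \<open>e B ` z\<close>.
\<close>

subsection \<open>Sets of size less than a regular uncountable cardinal\<close>

lemma P_less_mono: "x \<in> P_less r X \<Longrightarrow> X \<subseteq> Y \<Longrightarrow> x \<in> P_less r Y"
  unfolding P_less_def by blast

lemma P_less_subset: "x \<in> P_less r X \<Longrightarrow> y \<subseteq> x \<Longrightarrow> y \<in> P_less r X"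
  unfolding P_less_def using ordLeq_ordLess_trans[OF card_of_mono1] by blast

lemma P_less_in_subset: "x \<in> P_less r X \<Longrightarrow> x \<subseteq> Y \<Longrightarrow> x \<in> P_less r Y"
  unfolding P_less_def by blast

lemma P_less_image: "x \<in> P_less r X \<Longrightarrow> f ` x \<subseteq> Y \<Longrightarrow> f ` x \<in> P_less r Y"
  unfolding P_less_def using ordLeq_ordLess_trans[OF card_of_image] by blast

lemma P_less_ex_not_in_image:
  assumes "x \<in> P_less r X" "\<not> |I| <o r"
  shows "\<exists>i\<in>I. i \<notin> f ` x"
proof (rule ccontr)
  assume "\<not> ?thesis"
  then have "I \<subseteq> f ` x" by blast
  from ordLeq_transitive[OF card_of_mono1[OF this] card_of_image] have "|I| \<le>o |x|" .
  moreover have "|x| <o r" using assms(1) by (simp add: P_less_def)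
  ultimately show False using assms(2) ordLeq_ordLess_trans by blast
qed

locale regular_uncountable =
  fixes r :: "'k rel"
  assumes Card_order: "Card_order r" and regular: "regularCard r" and uncountable: "natLeq <o r"
begin

lemma Cinfinite: "Cinfinite r"
  using cinfinite_mono[OF ordLess_imp_ordLeq[OF uncountable] natLeq_cinfinite] Card_order by simp

lemma stable: "stable r"
  using regularCard_stable[OF Card_order _ regular] Cinfinite by (simp add: cinfinite_def)

lemma finite_ordLess: "finite A \<Longrightarrow> |A| <o r"
  using ordLess_transitive[OF _ uncountable] by (simp add: finite_iff_ordLess_natLeq)

lemma nat_ordLess: "|UNIV :: nat set| <o r"
  using ordIso_ordLess_trans[OF card_of_nat uncountable] .

lemma finite_in_P_less: "finite x \<Longrightarrow> x \<subseteq> X \<Longrightarrow> x \<in> P_less r X"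
  unfolding P_less_def by (simp add: finite_ordLess)

lemma P_less_UN: "|I| <o r \<Longrightarrow> (\<And>i. i \<in> I \<Longrightarrow> f i \<in> P_less r X) \<Longrightarrow> (\<Union>i\<in>I. f i) \<in> P_less r X"
  unfolding P_less_def using stable_UNION[OF stable, of I f] by auto

lemma P_less_Un: "x \<in> P_less r X \<Longrightarrow> y \<in> P_less r X \<Longrightarrow> x \<union> y \<in> P_less r X"
  unfolding P_less_def using Un_Cinfinite_bound_strict[OF _ _ Cinfinite] by blast

lemma Fpow_ordLess:
  assumes x: "|x| <o r"
  shows "|Fpow x| <o r"
proof -
  have "|{s \<in> Fpow x. card s = n}| <o r" for n
  proof (induction n)
    case 0
    have "{s \<in> Fpow x. card s = 0} = {{}}" by (auto simp: Fpow_def)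
    then show ?case by (simp add: finite_ordLess)
  next
    case (Suc n)
    have "|\<Union>a\<in>x. insert a ` {s \<in> Fpow x. card s = n}| <o r"
      using Suc by (intro stable_UNION[OF stable x] ordLeq_ordLess_trans[OF card_of_image])
    moreover have "{s \<in> Fpow x. card s = Suc n} \<subseteq> (\<Union>a\<in>x. insert a ` {s \<in> Fpow x. card s = n})"
      by (auto simp: Fpow_def card_Suc_eq)
    ultimately show ?case using ordLeq_ordLess_trans[OF card_of_mono1] by blast
  qed
  then have "|\<Union>n. {s \<in> Fpow x. card s = n}| <o r"
    by (intro stable_UNION[OF stable nat_ordLess])
  moreover have "(\<Union>n. {s \<in> Fpow x. card s = n}) = Fpow x" by blast
  ultimately show ?thesis by simp
qed

end

subsection \<open>Finitary hulls\<close>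

definition fin_hull :: "('a set \<Rightarrow> 'b set) \<Rightarrow> 'a set \<Rightarrow> 'b set" where
  "fin_hull F y = \<Union>(F ` Fpow y)"

lemma fin_hull_mono: "y \<subseteq> y' \<Longrightarrow> fin_hull F y \<subseteq> fin_hull F y'"
  unfolding fin_hull_def using Fpow_mono by blast

lemma fin_hull_Union_chain:
  assumes "subset.chain UNIV \<Y>" "\<Y> \<noteq> {}"
  shows "fin_hull F (\<Union>\<Y>) = (\<Union>y\<in>\<Y>. fin_hull F y)"
proof
  show "fin_hull F (\<Union>\<Y>) \<subseteq> (\<Union>y\<in>\<Y>. fin_hull F y)"
  proof
    fix a assume "a \<in> fin_hull F (\<Union>\<Y>)"
    then obtain s where s: "finite s" "s \<subseteq> \<Union>\<Y>" "a \<in> F s" unfolding fin_hull_def Fpow_def by blast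
    obtain y where "y \<in> \<Y>" "s \<subseteq> y"
      using finite_subset_Union_chain[OF s(1,2) assms(2,1)] .
    with s show "a \<in> (\<Union>y\<in>\<Y>. fin_hull F y)" unfolding fin_hull_def Fpow_def by blast
  qed
qed (intro UN_least fin_hull_mono Union_upper)

lemma subset_chain_image:
  assumes "total_on I r" "\<And>i j. i \<in> I \<Longrightarrow> j \<in> I \<Longrightarrow> (i, j) \<in> r \<Longrightarrow> f i \<subseteq> f j"
  shows "subset.chain UNIV (f ` I)"
  unfolding subset_chain_def
proof (intro conjI ballI)
  fix X Y assume "X \<in> f ` I" "Y \<in> f ` I"
  then obtain i j where "i \<in> I" "j \<in> I" "X = f i" "Y = f j" by blast
  then show "X \<subseteq> Y \<or> Y \<subseteq> X"
    using assms unfolding total_on_def by (cases "i = j") blast+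
qed simp

lemma fin_hull_UN_incseq:
  fixes f :: "nat \<Rightarrow> 'a set"
  assumes "\<And>n. f n \<subseteq> f (Suc n)"
  shows "fin_hull F (\<Union>n. f n) = (\<Union>n. fin_hull F (f n))"
proof -
  have "m \<le> n \<Longrightarrow> f m \<subseteq> f n" for m n using assms by (rule lift_Suc_mono_le)
  then have "subset.chain UNIV (range f)"
    by (intro subset_chain_image[of _ natLeq]) (auto simp: total_on_def natLeq_def)
  from fin_hull_Union_chain[OF this] show ?thesis by simp
qed

lemma fin_hull_Un:
  "fin_hull F (x \<union> y) = fin_hull (\<lambda>s. fin_hull F (s \<union> y)) x"
proof
  show "fin_hull F (x \<union> y) \<subseteq> fin_hull (\<lambda>s. fin_hull F (s \<union> y)) x"
  proof
    fix a assume "a \<in> fin_hull F (x \<union> y)"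
    then obtain s where s: "finite s" "s \<subseteq> x \<union> y" "a \<in> F s" unfolding fin_hull_def Fpow_def by blast
    then have "s \<in> Fpow ((s \<inter> x) \<union> y)" "s \<inter> x \<in> Fpow x" by (auto simp: Fpow_def)
    with s(3) show "a \<in> fin_hull (\<lambda>s. fin_hull F (s \<union> y)) x" unfolding fin_hull_def by blast
  qed
  show "fin_hull (\<lambda>s. fin_hull F (s \<union> y)) x \<subseteq> fin_hull F (x \<union> y)"
    unfolding fin_hull_def by (auto simp: Fpow_def)
qed

lemma underS_mono: "Well_order w \<Longrightarrow> (i, j) \<in> w \<Longrightarrow> underS w i \<subseteq> underS w j"
  unfolding well_order_on_def linear_order_on_def partial_order_on_def preorder_on_def
  by (intro underS_incr) auto

lemma UN_underS_infinite_Card_order: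
  assumes "Card_order w" "\<not> finite (Field w)"
  shows "(\<Union>i\<in>Field w. underS w i) = Field w"
proof
  show "(\<Union>i\<in>Field w. underS w i) \<subseteq> Field w" using underS_Field by fast
  show "Field w \<subseteq> (\<Union>i\<in>Field w. underS w i)"
    using infinite_Card_order_limit[OF assms] unfolding underS_def by blast
qed

lemma fin_hull_infinite_Card_order:
  assumes "Card_order w" "\<not> finite (Field w)"
  shows "fin_hull F (Field w) = (\<Union>i\<in>Field w. fin_hull F (underS w i))"
proof -
  have wo: "Well_order w" using assms(1) by (simp add: card_order_on_def)
  then have "total_on (Field w) w" unfolding well_order_on_def linear_order_on_def by simp
  then have "subset.chain UNIV (underS w ` Field w)"
    by (rule subset_chain_image) (rule underS_mono[OF wo])
  then have "fin_hull F (\<Union>i\<in>Field w. underS w i) = (\<Union>i\<in>Field w. fin_hull F (underS w i))"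
    using assms(2) by (subst fin_hull_Union_chain) auto
  then show ?thesis by (simp add: UN_underS_infinite_Card_order[OF assms])
qed

subsection \<open>Clubs and stationary sets\<close>

lemma club_imp_P_less: "club r X C \<Longrightarrow> y \<in> C \<Longrightarrow> y \<in> P_less r X"
  unfolding club_def by blast

lemma club_cofinal: "club r X C \<Longrightarrow> x \<in> P_less r X \<Longrightarrow> \<exists>y\<in>C. x \<subseteq> y"
  unfolding club_def by blast

context regular_uncountable
begin

lemma fin_hull_in_P_less:
  assumes K: "\<And>s. s \<in> Fpow X \<Longrightarrow> K s \<in> P_less r Y" and y: "y \<in> P_less r X"
  shows "fin_hull K y \<in> P_less r Y"
  unfolding fin_hull_def
proof (rule P_less_UN)
  show "|Fpow y| <o r" using y Fpow_ordLess[of y] by (simp add: P_less_def)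
  show "K s \<in> P_less r Y" if "s \<in> Fpow y" for s
    using that y K by (auto simp: P_less_def Fpow_def)
qed

lemma ex_fin_hull_closed_superset:
  assumes K: "\<And>s. s \<in> Fpow X \<Longrightarrow> K s \<in> P_less r X" and x: "x \<in> P_less r X"
  shows "\<exists>y\<in>P_less r X. x \<subseteq> y \<and> fin_hull K y \<subseteq> y"
proof -
  define f where "f n = ((\<lambda>y. y \<union> fin_hull K y) ^^ n) x" for n
  have f_Suc: "f (Suc n) = f n \<union> fin_hull K (f n)" for n by (simp add: f_def)
  have "f n \<in> P_less r X" for n
  proof (induction n)
    case 0
    then show ?case using x by (simp add: f_def)
  next
    case (Suc n)
    then show ?case unfolding f_Suc using K by (intro P_less_Un fin_hull_in_P_less)
  qed
  then have "(\<Union>n. f n) \<in> P_less r X" by (intro P_less_UN nat_ordLess)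
  moreover have "fin_hull K (\<Union>n. f n) \<subseteq> (\<Union>n. f n)"
  proof -
    have "fin_hull K (\<Union>n. f n) = (\<Union>n. fin_hull K (f n))"
      by (rule fin_hull_UN_incseq) (simp add: f_Suc)
    also have "\<dots> \<subseteq> (\<Union>n. f (Suc n))" unfolding f_Suc by blast
    also have "\<dots> \<subseteq> (\<Union>n. f n)" by blast
    finally show ?thesis .
  qed
  moreover have "x \<subseteq> (\<Union>n. f n)" using UN_upper[of 0 UNIV f] by (simp add: f_def)
  ultimately show ?thesis by blast
qed

lemma club_fin_hull_closed:
  assumes K: "\<And>s. s \<in> Fpow X \<Longrightarrow> K s \<in> P_less r X"
  shows "club r X {x \<in> P_less r X. fin_hull K x \<subseteq> x}" (is "club r X ?D")
  unfolding club_def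
proof (intro conjI ballI allI impI)
  show "\<exists>y\<in>?D. x \<subseteq> y" if "x \<in> P_less r X" for x
  proof -
    obtain y where "y \<in> P_less r X" "x \<subseteq> y" "fin_hull K y \<subseteq> y"
      using ex_fin_hull_closed_superset[where K = K, OF K \<open>x \<in> P_less r X\<close>] by auto
    then show ?thesis by (intro bexI[of _ y]) simp_all
  qed
next
  fix \<delta> and f :: "'k \<Rightarrow> 'a set"
  let ?I = "underS r \<delta>"
  assume \<delta>: "\<delta> \<in> Field r" and f: "?I \<noteq> {} \<and> (\<forall>i\<in>?I. f i \<in> ?D) \<and>
       (\<forall>i\<in>?I. \<forall>j\<in>?I. (i, j) \<in> r \<longrightarrow> f i \<subseteq> f j)"
  have "total_on ?I r"
    using Card_order underS_Field[of _ r \<delta>] unfolding card_order_on_def well_order_on_def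
      linear_order_on_def total_on_def by blast
  then have "subset.chain UNIV (f ` ?I)" using f by (intro subset_chain_image) blast+
  then have "fin_hull K (\<Union>i\<in>?I. f i) = (\<Union>i\<in>?I. fin_hull K (f i))"
    using f by (simp add: fin_hull_Union_chain)
  also have "\<dots> \<subseteq> (\<Union>i\<in>?I. f i)" using f by blast
  finally show "(\<Union>i\<in>?I. f i) \<in> ?D"
    using f P_less_UN[OF card_of_underS[OF Card_order \<delta>], of f X] by simp
qed simp

lemma stationary_meets_fin_hull_closed:
  assumes "stationary r X S" "\<And>s. s \<in> Fpow X \<Longrightarrow> K s \<in> P_less r X"
  shows "\<exists>x\<in>S. fin_hull K x \<subseteq> x"
proof -
  have "club r X {x \<in> P_less r X. fin_hull K x \<subseteq> x}"
    using assms(2) by (rule club_fin_hull_closed)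
  with assms(1) have "S \<inter> {x \<in> P_less r X. fin_hull K x \<subseteq> x} \<noteq> {}"
    unfolding stationary_def by simp
  then show ?thesis by blast
qed

lemma stationary_closed_under_functions:
  assumes S: "stationary r X S" and \<Phi>: "finite \<Phi>"
  shows "\<exists>x\<in>S. \<forall>\<phi>\<in>\<Phi>. \<forall>a\<in>x. \<phi> a \<in> X \<longrightarrow> \<phi> a \<in> x"
proof -
  define K where "K s = (\<Union>\<phi>\<in>\<Phi>. \<phi> ` s) \<inter> X" for s
  have "K s \<in> P_less r X" if "s \<in> Fpow X" for s
    using that \<Phi> by (intro finite_in_P_less) (auto simp: K_def Fpow_def)
  from stationary_meets_fin_hull_closed[where K = K, OF S this]
  obtain x where x: "x \<in> S" "fin_hull K x \<subseteq> x" by blast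
  have "\<phi> a \<in> x" if "\<phi> \<in> \<Phi>" "a \<in> x" "\<phi> a \<in> X" for \<phi> a
  proof -
    have "{a} \<in> Fpow x" "\<phi> a \<in> K {a}" using that by (auto simp: K_def Fpow_def)
    then show ?thesis using x(2) unfolding fin_hull_def by blast
  qed
  with x(1) show ?thesis by blast
qed

text \<open>The definition of clubs only speaks of chains indexed by initial segments of the cardinal.\<close>

lemma club_Union_chain:
  assumes C: "club r X C" and w: "Well_order w" "w <o r" "Field w \<noteq> {}"
    and f: "\<And>i. i \<in> Field w \<Longrightarrow> f i \<in> C" "\<And>i j. (i, j) \<in> w \<Longrightarrow> f i \<subseteq> f j"
  shows "(\<Union>i\<in>Field w. f i) \<in> C"
proof -
  have wo: "Well_order r" using Card_order by (simp add: card_order_on_def)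
  obtain \<delta> where \<delta>: "\<delta> \<in> Field r" "w =o Restr r (underS r \<delta>)"
    using ordLess_iff_ordIso_Restr[OF wo w(1)] w(2) by blast
  let ?I = "underS r \<delta>"
  obtain g where g: "iso (Restr r ?I) w g"
    using ordIso_symmetric[OF \<delta>(2)] unfolding ordIso_def by blast
  have "Field (Restr r ?I) = ?I"
    using wo by (simp add: wo_rel_def wo_rel.underS_ofilter Field_Restr_ofilter)
  then have image: "g ` ?I = Field w"
    using g unfolding iso_iff2 bij_betw_def by simp
  have "?I \<noteq> {}" using image w(3) by auto
  moreover have "\<forall>i\<in>?I. (f \<circ> g) i \<in> C" using image f(1) by auto
  moreover have "\<forall>i\<in>?I. \<forall>j\<in>?I. (i, j) \<in> r \<longrightarrow> (f \<circ> g) i \<subseteq> (f \<circ> g) j"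
    using iso_forward[OF _ g] f(2) by simp
  ultimately have "(\<Union>i\<in>?I. (f \<circ> g) i) \<in> C"
    using C \<delta>(1) unfolding club_def by blast
  also have "(\<Union>i\<in>?I. (f \<circ> g) i) = (\<Union>i\<in>Field w. f i)"
    unfolding image[symmetric] by simp
  finally show ?thesis .
qed

lemma club_monotone_selection:
  assumes C: "club r X C"
  shows "\<exists>F. \<forall>s\<in>Fpow X. F s \<in> C \<and> s \<subseteq> F s \<and> (\<forall>t\<subseteq>s. F t \<subseteq> F s)"
proof -
  let ?above = "\<lambda>F s y. s \<in> Fpow X \<longrightarrow> y \<in> C \<and> s \<union> (\<Union>t\<in>{t. t \<subset> s}. F t) \<subseteq> y"
  have "\<exists>F. \<forall>s. ?above F s (F s)"
  proof (rule dependent_wf_choice[OF wf_finite_psubset])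
    fix F G :: "'a set \<Rightarrow> 'a set" and s y
    assume "\<And>t. (t, s) \<in> finite_psubset \<Longrightarrow> F t = G t"
    then have "s \<in> Fpow X \<Longrightarrow> (\<Union>t\<in>{t. t \<subset> s}. F t) = (\<Union>t\<in>{t. t \<subset> s}. G t)"
      by (auto simp: finite_psubset_def Fpow_def)
    then show "?above F s y \<longleftrightarrow> ?above G s y" by auto
  next
    fix s and F :: "'a set \<Rightarrow> 'a set"
    assume smaller: "\<And>t. (t, s) \<in> finite_psubset \<Longrightarrow> ?above F t (F t)"
    show "\<exists>y. ?above F s y"
    proof (cases "s \<in> Fpow X")
      case True
      then have s: "finite s" "s \<subseteq> X" by (simp_all add: Fpow_def)
      have "F t \<in> P_less r X" if "t \<subset> s" for t
      proof -
        have "(t, s) \<in> finite_psubset" "t \<in> Fpow X"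
          using that s finite_subset[of t s] by (auto simp: finite_psubset_def Fpow_def)
        then show ?thesis using smaller club_imp_P_less[OF C] by blast
      qed
      moreover have "finite {t. t \<subset> s}"
        by (rule finite_subset[of _ "Pow s"]) (use s in auto)
      ultimately have "s \<union> (\<Union>t\<in>{t. t \<subset> s}. F t) \<in> P_less r X"
        by (intro P_less_Un[OF finite_in_P_less[OF s]] P_less_UN finite_ordLess) auto
      from club_cofinal[OF C this] show ?thesis by blast
    qed simp
  qed
  then obtain F where "\<And>s. s \<in> Fpow X \<Longrightarrow> F s \<in> C \<and> s \<union> (\<Union>t\<in>{t. t \<subset> s}. F t) \<subseteq> F s" by blast
  moreover from this have "F t \<subseteq> F s" if "s \<in> Fpow X" "t \<subseteq> s" for s t
    using that by (cases "t = s") blast+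
  ultimately have "\<forall>s\<in>Fpow X. F s \<in> C \<and> s \<subseteq> F s \<and> (\<forall>t\<subseteq>s. F t \<subseteq> F s)" by simp
  then show ?thesis by (intro exI)
qed

text \<open>Induction on \<open>|y|\<close>: an infinite \<open>y\<close> is the union of its proper initial segments, which have
  smaller cardinality.\<close>

lemma fin_hull_monotone_in_club:
  assumes C: "club r X C" and F: "\<And>s. s \<in> Fpow X \<Longrightarrow> F s \<in> C"
    and F_mono: "\<And>s t. s \<in> Fpow X \<Longrightarrow> t \<subseteq> s \<Longrightarrow> F t \<subseteq> F s"
  shows "y \<in> P_less r X \<Longrightarrow> fin_hull F y \<in> C"
proof (induction y rule: wf_induct_rule[OF wf_inv_image[OF wf_ordLess, of card_of], case_names less])
  case (less y)
  then have y: "y \<subseteq> X" "|y| <o r" by (simp_all add: P_less_def)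
  show ?case
  proof (cases "finite y")
    case True
    then have "y \<in> Fpow X" using y(1) by (simp add: Fpow_def)
    moreover from this have "fin_hull F y = F y"
      using F_mono unfolding fin_hull_def Fpow_def by blast
    ultimately show ?thesis using F by simp
  next
    case False
    let ?w = "|y|"
    have w: "Card_order ?w" "Well_order ?w" "Field ?w = y"
      by (rule card_of_Card_order card_of_Well_order Field_card_of)+
    have hull: "fin_hull F (underS ?w i) \<in> C" if "i \<in> Field ?w" for i
    proof (rule less.IH)
      show "(underS ?w i, y) \<in> inv_image ordLess card_of"
        using card_of_underS[OF w(1) that] by (simp add: inv_image_def)
      show "underS ?w i \<in> P_less r X"
        by (rule P_less_subset[OF less.prems]) (use underS_Field w(3) in fast)
    qed
    have "Field ?w \<noteq> {}" using False w(3) by auto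
    with hull have "(\<Union>i\<in>Field ?w. fin_hull F (underS ?w i)) \<in> C"
      by (intro club_Union_chain[OF C w(2) y(2)] fin_hull_mono underS_mono w)
    then show ?thesis using fin_hull_infinite_Card_order[OF w(1), of F] False w(3) by simp
  qed
qed

lemma club_contains_fin_hulls:
  assumes C: "club r X C"
  shows "\<exists>F. \<forall>y\<in>P_less r X. fin_hull F y \<in> C \<and> y \<subseteq> fin_hull F y"
proof -
  obtain F where sel: "\<forall>s\<in>Fpow X. F s \<in> C \<and> s \<subseteq> F s \<and> (\<forall>t\<subseteq>s. F t \<subseteq> F s)"
    using club_monotone_selection[OF C] by (rule exE)
  have F: "F s \<in> C" "s \<subseteq> F s" "t \<subseteq> s \<Longrightarrow> F t \<subseteq> F s" if "s \<in> Fpow X" for s t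
    using bspec[OF sel that] by blast+
  have "y \<subseteq> fin_hull F y" if "y \<in> P_less r X" for y
  proof
    fix a assume a: "a \<in> y"
    then have "{a} \<in> Fpow X" using that by (auto simp: P_less_def Fpow_def)
    then have "a \<in> F {a}" using F(2) by blast
    moreover have "{a} \<in> Fpow y" using a by (simp add: Fpow_def)
    ultimately show "a \<in> fin_hull F y" unfolding fin_hull_def by (intro UN_I)
  qed
  moreover have "fin_hull F y \<in> C" if "y \<in> P_less r X" for y
    by (rule fin_hull_monotone_in_club[OF C F(1,3) that])
  ultimately show ?thesis by (intro exI[of _ F]) simp
qed

end

subsection \<open>Games of length \<open>\<omega>\<close>\<close>

text \<open>
  A strategy of the opponent is a well-founded tree: the game is closed for the other player, so that
  a winning opponent wins after finitely many rounds.
\<close>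

datatype ('m, 'p) strategy = Resign | Move (first_move: 'm) (after: "'p \<Rightarrow> ('m, 'p) strategy")

primrec winning :: "('m \<Rightarrow> bool) \<Rightarrow> ('p \<Rightarrow> 'm \<Rightarrow> 'p \<Rightarrow> bool) \<Rightarrow> ('m, 'p) strategy \<Rightarrow> 'p \<Rightarrow> bool" where
  "winning M legal Resign p \<longleftrightarrow> False"
| "winning M legal (Move m t) p \<longleftrightarrow> M m \<and> (\<forall>p'. legal p m p' \<longrightarrow> winning M legal (t p') p')"

definition unbeaten :: "('m \<Rightarrow> bool) \<Rightarrow> ('p \<Rightarrow> 'm \<Rightarrow> 'p \<Rightarrow> bool) \<Rightarrow> 'p \<Rightarrow> bool" where
  "unbeaten M legal p \<longleftrightarrow> (\<nexists>t. winning M legal t p)"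

lemma winning_first_move: "winning M legal t p \<Longrightarrow> M (first_move t)"
  by (cases t) simp_all

lemma unbeaten_reply:
  assumes p: "unbeaten M legal p" and m: "M m"
  shows "\<exists>p'. legal p m p' \<and> unbeaten M legal p'"
proof (rule ccontr)
  assume "\<not> ?thesis"
  then have "\<forall>p'. \<exists>t. legal p m p' \<longrightarrow> winning M legal t p'" unfolding unbeaten_def by blast
  then obtain t where "\<And>p'. legal p m p' \<Longrightarrow> winning M legal (t p') p'" by metis
  then have "winning M legal (Move m t) p" using m by simp
  with p show False unfolding unbeaten_def by blast
qed

lemma interleaved_plays:
  assumes start: "\<forall>i\<in>I. unbeaten M legal (p i)"
    and move: "\<And>\<beta>. \<forall>i\<in>I. unbeaten M legal (\<beta> i) \<Longrightarrow> M (G \<beta>)"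
  shows "\<exists>\<beta>. \<beta> 0 = p \<and> (\<forall>n. \<forall>i\<in>I. legal (\<beta> n i) (G (\<beta> n)) (\<beta> (Suc n) i))"
proof -
  obtain reply where reply: "\<And>p m. unbeaten M legal p \<Longrightarrow> M m \<Longrightarrow>
      legal p m (reply p m) \<and> unbeaten M legal (reply p m)"
    using unbeaten_reply[of M legal] by metis
  define \<beta> where "\<beta> = rec_nat p (\<lambda>_ \<beta> i. reply (\<beta> i) (G \<beta>))"
  have \<beta>: "\<beta> 0 = p" "\<beta> (Suc n) i = reply (\<beta> n i) (G (\<beta> n))" for n i
    by (simp_all add: \<beta>_def)
  have "\<forall>i\<in>I. unbeaten M legal (\<beta> n i)" for n
  proof (induction n)
    case 0
    then show ?case using start by (simp add: \<beta>)
  next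
    case (Suc n)
    then show ?case using move reply by (simp add: \<beta>)
  qed
  then show ?thesis using move reply by (intro exI[of _ \<beta>]) (simp add: \<beta>)
qed

lemma no_infinite_play_against_winning:
  assumes "winning M legal (\<tau> 0) (f 0)"
    and "\<And>n. winning M legal (\<tau> n) (f n) \<Longrightarrow>
      legal (f n) (first_move (\<tau> n)) (f (Suc n)) \<and> \<tau> (Suc n) = after (\<tau> n) (f (Suc n))"
  shows False
  using assms
proof (induction "\<tau> 0" arbitrary: \<tau> f)
  case Resign
  from this(2) show False unfolding Resign(1)[symmetric] by simp
next
  case (Move m t)
  have step: "legal (f 0) m (f 1)" "\<tau> 1 = t (f 1)"
    using Move.prems(2)[OF Move.prems(1)] by (simp_all flip: Move.hyps(2))
  show False
  proof (rule Move.hyps(1)[of "\<lambda>n. \<tau> (Suc n)" "\<lambda>n. f (Suc n)"])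
    show "winning M legal (\<tau> (Suc 0)) (f (Suc 0))"
      using Move.prems(1) step by (simp flip: Move.hyps(2))
  qed (use step Move.prems(2) in simp_all)
qed

text \<open>
  One plays at once against a family \<open>t\<close> of strategies. The reply only takes those into account that
  are still winning; a winning strategy can only cease to be so when \<open>alive z\<close> is violated.
\<close>

lemma simultaneous_play:
  fixes legal :: "'z \<Rightarrow> 'p \<Rightarrow> 'm \<Rightarrow> 'p \<Rightarrow> bool"
  assumes start: "P p"
    and reply: "\<And>p W g. P p \<Longrightarrow> W \<subseteq> Z \<Longrightarrow> \<forall>z\<in>W. M (g z) \<Longrightarrow>
      \<exists>p'. P p' \<and> Q p p' \<and> (\<forall>z\<in>W. alive z p' \<longrightarrow> legal z p (g z) p')"
  obtains f \<tau> where "f 0 = p" "\<tau> 0 = t" "\<And>n. P (f n)" "\<And>n. Q (f n) (f (Suc n))"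
    "\<And>n z. \<tau> (Suc n) z = after (\<tau> n z) (f (Suc n))"
    "\<And>n z. z \<in> Z \<Longrightarrow> winning M (legal z) (\<tau> n z) (f n) \<Longrightarrow> alive z (f (Suc n)) \<Longrightarrow>
      legal z (f n) (first_move (\<tau> n z)) (f (Suc n))"
proof -
  let ?answers = "\<lambda>\<tau> p p'. P p' \<and> Q p p' \<and>
    (\<forall>z\<in>Z. winning M (legal z) (\<tau> z) p \<and> alive z p' \<longrightarrow> legal z p (first_move (\<tau> z)) p')"
  define a where "a \<tau> p = (SOME p'. ?answers \<tau> p p')" for \<tau> :: "'z \<Rightarrow> ('m, 'p) strategy" and p
  have a: "?answers \<tau> p (a \<tau> p)" if "P p" for \<tau> p
  proof -
    have "\<exists>p'. ?answers \<tau> p p'"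
      using reply[of p "{z \<in> Z. winning M (legal z) (\<tau> z) p}" "\<lambda>z. first_move (\<tau> z)"]
        that winning_first_move by fastforce
    then show ?thesis unfolding a_def by (rule someI_ex)
  qed
  define s where "s = rec_nat (p, t) (\<lambda>_ (p, \<tau>). (a \<tau> p, \<lambda>z. after (\<tau> z) (a \<tau> p)))"
  define f where "f n = fst (s n)" for n
  define \<tau> where "\<tau> n = snd (s n)" for n
  have f: "f 0 = p" "f (Suc n) = a (\<tau> n) (f n)" for n
    by (simp_all add: f_def \<tau>_def s_def case_prod_unfold)
  have \<tau>: "\<tau> 0 = t" "\<tau> (Suc n) = (\<lambda>z. after (\<tau> n z) (f (Suc n)))" for n
    by (simp_all add: f_def \<tau>_def s_def case_prod_unfold)
  have P: "P (f n)" for n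
  proof (induction n)
    case 0
    then show ?case using start by (simp add: f)
  next
    case (Suc n)
    then show ?case using a by (simp add: f)
  qed
  show thesis
    by (rule that[of f \<tau>]) (use a[OF P] P in \<open>simp_all add: f \<tau>\<close>)
qed

lemma ex_unbeaten_if_simultaneous_replies:
  fixes legal :: "'z \<Rightarrow> 'p \<Rightarrow> 'm \<Rightarrow> 'p \<Rightarrow> bool"
  assumes start: "P p"
    and reply: "\<And>p W g. P p \<Longrightarrow> W \<subseteq> Z \<Longrightarrow> \<forall>z\<in>W. M (g z) \<Longrightarrow>
      \<exists>p'. P p' \<and> Q p p' \<and> (\<forall>z\<in>W. alive z p' \<longrightarrow> legal z p (g z) p')"
    and survivor: "\<And>f. f 0 = p \<Longrightarrow> \<forall>n. P (f n) \<and> Q (f n) (f (Suc n)) \<Longrightarrow> \<exists>z\<in>Z. \<forall>n. alive z (f n)"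
  shows "\<exists>z\<in>Z. unbeaten M (legal z) p"
proof (rule ccontr)
  assume "\<not> ?thesis"
  then obtain t where t: "\<And>z. z \<in> Z \<Longrightarrow> winning M (legal z) (t z) p"
    unfolding unbeaten_def by metis
  obtain f \<tau> where f: "f 0 = p" "\<And>n. P (f n)" "\<And>n. Q (f n) (f (Suc n))"
    and \<tau>: "\<tau> 0 = t" "\<And>n z. \<tau> (Suc n) z = after (\<tau> n z) (f (Suc n))"
      "\<And>n z. z \<in> Z \<Longrightarrow> winning M (legal z) (\<tau> n z) (f n) \<Longrightarrow> alive z (f (Suc n)) \<Longrightarrow>
        legal z (f n) (first_move (\<tau> n z)) (f (Suc n))"
    using simultaneous_play[of P p Z M Q alive legal t, OF start reply] by blast
  obtain z where z: "z \<in> Z" "\<And>n. alive z (f n)" using survivor[of f] f by blast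
  show False
  proof (rule no_infinite_play_against_winning[of M "legal z" "\<lambda>n. \<tau> n z" f])
    show "winning M (legal z) (\<tau> 0 z) (f 0)" using t[OF z(1)] f(1) \<tau>(1) by simp
  qed (use z \<tau> in simp)
qed

subsection \<open>The diagonal family\<close>

locale covering_setting =
  nu: regular_uncountable \<nu> + kappa: regular_uncountable \<kappa>
  for \<nu> :: "'n rel" and \<kappa> :: "'k rel" +
  fixes \<mu> \<Lambda> :: "'a rel" and c :: "'a \<Rightarrow> 'a set" and T :: "'a set set" and E :: "'a \<Rightarrow> 'a set"
  assumes nu_less_kappa: "\<nu> <o \<kappa>" and kappa_le_mu: "\<kappa> \<le>o \<mu>" and mu_less_Lambda: "\<mu> <o \<Lambda>"
    and Card_order_mu: "Card_order \<mu>" and Card_order_Lambda: "Card_order \<Lambda>"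
    and mu_subset: "Field \<mu> \<subseteq> Field \<Lambda>"
    and E: "\<And>\<alpha>. \<alpha> \<in> Field \<Lambda> \<Longrightarrow> E \<alpha> \<in> P_eq \<mu> (Field \<Lambda>)"
    and cov: "\<And>B. B \<in> P_eq \<mu> (Field \<Lambda>) \<Longrightarrow> \<exists>a\<in>P_less \<nu> (Field \<Lambda>). B \<subseteq> (\<Union>\<alpha>\<in>a. E \<alpha>)"
    and T_stationary: "stationary \<kappa> (Field \<mu>) T" and card_T: "|T| \<le>o \<mu>"
    and c_unbounded: "\<And>z. z \<in> T \<Longrightarrow> unbounded_in \<nu> z {c \<xi> | \<xi>. \<xi> \<in> z}"
begin

abbreviation "M \<equiv> Field \<mu>"
abbreviation "L \<equiv> Field \<Lambda>"

definition small :: "'a set \<Rightarrow> bool" where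
  "small G \<longleftrightarrow> G \<subseteq> L \<and> |G| \<le>o \<mu>"

definition covered :: "'a set \<Rightarrow> 'a set" where
  "covered b = (\<Union>\<alpha>\<in>b. E \<alpha>)"

definition E_closed :: "'a set \<Rightarrow> bool" where
  "E_closed B \<longleftrightarrow> (\<forall>\<alpha>\<in>B. E \<alpha> \<subseteq> B)"

text \<open>\<open>enumeration B\<close> is arbitrary unless \<open>|B| \<le> \<mu>\<close>.\<close>

definition enumeration :: "'a set \<Rightarrow> 'a \<Rightarrow> 'a" where
  "enumeration B = (SOME g. B \<subseteq> g ` M)"

definition diagonal_family :: "'a set set" where
  "diagonal_family = {x \<in> P_less \<kappa> L. x \<inter> M \<in> T \<and>
     (\<exists>b\<in>P_less \<nu> x. covered b = E_closed hull x) \<and>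
     \<not> x \<subseteq> enumeration (E_closed hull x) ` (x \<inter> M)}"

lemma Cinfinite_mu: "Cinfinite \<mu>"
  using cinfinite_mono[OF kappa_le_mu] kappa.Cinfinite Card_order_mu by blast

lemma card_M: "|M| =o \<mu>"
  using card_of_Field_ordIso[OF Card_order_mu] .

lemma P_nu_imp_P_kappa: "b \<in> P_less \<nu> X \<Longrightarrow> b \<in> P_less \<kappa> X"
  unfolding P_less_def using ordLess_transitive[OF _ nu_less_kappa] by blast

lemma P_kappa_imp_small: "x \<in> P_less \<kappa> L \<Longrightarrow> small x"
  using ordLess_ordLeq_trans[OF _ kappa_le_mu, THEN ordLess_imp_ordLeq, of "|x|"]
  by (simp add: P_less_def small_def)

lemma small_Un: "small A \<Longrightarrow> small B \<Longrightarrow> small (A \<union> B)"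
  unfolding small_def using Un_Cinfinite_bound[OF _ _ Cinfinite_mu] by blast

lemma small_UN: "|I| \<le>o \<mu> \<Longrightarrow> (\<And>i. i \<in> I \<Longrightarrow> small (A i)) \<Longrightarrow> small (\<Union>i\<in>I. A i)"
  unfolding small_def using UNION_Cinfinite_bound[OF _ _ Cinfinite_mu, of I A] by blast

lemma small_covered: "small b \<Longrightarrow> small (covered b)"
  unfolding covered_def
proof (rule small_UN)
  show "small (E \<alpha>)" if "small b" "\<alpha> \<in> b" for \<alpha>
    using E[of \<alpha>] that ordIso_imp_ordLeq by (auto simp: small_def P_eq_def)
qed (simp_all add: small_def)

lemma covered_mono: "b \<subseteq> b' \<Longrightarrow> covered b \<subseteq> covered b'"
  unfolding covered_def by blast

lemma covered_subset_E_closed: "E_closed B \<Longrightarrow> b \<subseteq> B \<Longrightarrow> covered b \<subseteq> B"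
  unfolding covered_def E_closed_def by blast

lemma small_subset_covered:
  assumes "small G"
  shows "\<exists>a\<in>P_less \<nu> L. G \<subseteq> covered a"
proof -
  have "small (G \<union> M)"
    using assms mu_subset ordIso_imp_ordLeq[OF card_M] by (intro small_Un) (simp_all add: small_def)
  moreover have "\<mu> \<le>o |G \<union> M|"
    by (rule ordIso_ordLeq_trans[OF ordIso_symmetric[OF card_M] card_of_mono1]) simp
  ultimately have "G \<union> M \<in> P_eq \<mu> L" by (simp add: small_def P_eq_def ordIso_iff_ordLeq)
  from cov[OF this] show ?thesis unfolding covered_def by blast
qed

lemma subset_enumeration:
  assumes "small B"
  shows "B \<subseteq> enumeration B ` M"
proof -
  have "\<exists>g. B \<subseteq> g ` M"
  proof (cases "B = {}")
    case False
    have "|B| \<le>o |M|"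
      using assms ordLeq_ordIso_trans[OF _ ordIso_symmetric[OF card_M], of "|B|"]
      by (simp add: small_def)
    then obtain g where "g ` M = B" using card_of_ordLeq2[OF False, of M] by auto
    then show ?thesis by blast
  qed simp
  then show ?thesis unfolding enumeration_def by (rule someI_ex)
qed

lemma c_cofinal:
  assumes "z \<in> T" "x \<in> P_less \<nu> z"
  shows "\<exists>\<xi>\<in>z. x \<subseteq> c \<xi> \<and> c \<xi> \<subseteq> z"
proof -
  have "\<exists>y\<in>{c \<xi> | \<xi>. \<xi> \<in> z}. x \<subseteq> y" "{c \<xi> | \<xi>. \<xi> \<in> z} \<subseteq> P_less \<nu> z"
    using c_unbounded[OF assms(1)] assms(2) unfolding unbounded_in_def by simp_all
  then show ?thesis by (auto simp: P_less_def)
qed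

lemma E_closed_hull: "E_closed (E_closed hull x)"
  by (rule hull_in) (auto simp: E_closed_def)

lemma covered_eq_hull:
  assumes "E_closed (covered b)" "b \<subseteq> x" "x \<subseteq> covered b"
  shows "covered b = E_closed hull x"
proof (rule hull_unique[symmetric])
  show "covered b \<subseteq> B" if "x \<subseteq> B" "E_closed B" for B
    using that(2) by (rule covered_subset_E_closed) (use assms(2) that(1) in blast)
qed (use assms in simp_all)

subsection \<open>Nonreflection\<close>

lemma hull_diagonal_eq_covered_code:
  assumes x: "x \<in> diagonal_family" and m: "bij_betw m M A" and "x \<subseteq> A"
    and closed: "\<And>\<xi>. \<xi> \<in> x \<inter> M \<Longrightarrow> m \<xi> \<in> x" "\<And>\<gamma>. \<gamma> \<in> x \<Longrightarrow> inv_into M m \<gamma> \<in> x"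
  shows "\<exists>\<xi>\<in>x \<inter> M. covered (m ` c \<xi>) = E_closed hull x"
proof -
  let ?z = "x \<inter> M"
  obtain b where b: "b \<in> P_less \<nu> x" "covered b = E_closed hull x" and z: "?z \<in> T"
    using x unfolding diagonal_family_def by blast
  have bx: "b \<subseteq> x" using b(1) by (simp add: P_less_def)
  then have m_inv: "m (inv_into M m \<gamma>) = \<gamma>" "inv_into M m \<gamma> \<in> M" if "\<gamma> \<in> b" for \<gamma>
    using that m \<open>x \<subseteq> A\<close> unfolding bij_betw_def by (auto intro: f_inv_into_f inv_into_into)
  have "inv_into M m ` b \<in> P_less \<nu> ?z"
    using b(1) by (rule P_less_image) (use bx closed(2) m_inv(2) in blast)
  then obtain \<xi> where \<xi>: "\<xi> \<in> ?z" "inv_into M m ` b \<subseteq> c \<xi>" "c \<xi> \<subseteq> ?z"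
    using c_cofinal[OF z] by blast
  have "b \<subseteq> m ` c \<xi>"
    using \<xi>(2) m_inv(1) by (metis image_eqI image_subset_iff subsetI)
  then have "E_closed hull x \<subseteq> covered (m ` c \<xi>)" using covered_mono b(2) by blast
  moreover have "m ` c \<xi> \<subseteq> E_closed hull x"
    using \<xi>(3) closed(1) hull_subset[of x E_closed] by blast
  then have "covered (m ` c \<xi>) \<subseteq> E_closed hull x"
    by (rule covered_subset_E_closed[OF E_closed_hull])
  ultimately show ?thesis using \<xi>(1) by blast
qed

lemma small_hull_diagonal:
  assumes "x \<in> diagonal_family"
  shows "small (E_closed hull x)"
proof -
  obtain b where b: "b \<in> P_less \<nu> x" "covered b = E_closed hull x" and "x \<subseteq> L"
    using assms unfolding diagonal_family_def P_less_def by auto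
  have "small b" by (intro P_kappa_imp_small P_nu_imp_P_kappa P_less_mono[OF b(1) \<open>x \<subseteq> L\<close>])
  then show ?thesis using small_covered b(2) by metis
qed

lemma diagonal_family_index_escapes:
  assumes x: "x \<in> diagonal_family"
  shows "\<exists>\<gamma>\<in>x. inv_into M (enumeration (E_closed hull x)) \<gamma> \<in> M - x"
proof -
  let ?e = "enumeration (E_closed hull x)"
  obtain \<gamma> where \<gamma>: "\<gamma> \<in> x" "\<gamma> \<notin> ?e ` (x \<inter> M)" using x unfolding diagonal_family_def by blast
  have "\<gamma> \<in> ?e ` M"
    using subset_enumeration[OF small_hull_diagonal[OF x]] hull_subset[of x E_closed] \<gamma>(1) by blast
  then have "inv_into M ?e \<gamma> \<in> M" "?e (inv_into M ?e \<gamma>) = \<gamma>"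
    by (rule inv_into_into, rule f_inv_into_f)
  with \<gamma> show ?thesis by (metis Diff_iff IntI image_eqI)
qed

lemma diagonal_family_nonreflecting:
  assumes "M \<subseteq> A" and card_A: "|A| =o \<mu>"
  shows "\<not> stationary \<kappa> A (diagonal_family \<inter> P_less \<kappa> A)"
proof
  assume stationary: "stationary \<kappa> A (diagonal_family \<inter> P_less \<kappa> A)"
  obtain m where m: "bij_betw m M A"
    using ordIso_transitive[OF card_M ordIso_symmetric[OF card_A]] card_of_ordIso by blast
  define missed where "missed \<xi> = (SOME a. a \<in> A - covered (m ` c \<xi>))" for \<xi>
  define index where "index = inv_into M (enumeration (E_closed hull A))"
  obtain x where x: "x \<in> diagonal_family" "x \<subseteq> A"
    and closed: "\<forall>\<phi>\<in>{m, inv_into M m, missed, index}. \<forall>a\<in>x. \<phi> a \<in> A \<longrightarrow> \<phi> a \<in> x"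
    using kappa.stationary_closed_under_functions[OF stationary, of "{m, inv_into M m, missed, index}"]
    by (auto simp: P_less_def)
  have "m \<eta> \<in> x" if "\<eta> \<in> x \<inter> M" for \<eta> using that closed m by (auto simp: bij_betw_def)
  moreover have "inv_into M m \<gamma> \<in> x" if "\<gamma> \<in> x" for \<gamma>
  proof -
    have "inv_into M m \<gamma> \<in> M"
      by (rule inv_into_into) (use that m x(2) in \<open>auto simp: bij_betw_def\<close>)
    then show ?thesis using that closed \<open>M \<subseteq> A\<close> by auto
  qed
  ultimately obtain \<xi> where \<xi>: "\<xi> \<in> x \<inter> M" and hull_x: "covered (m ` c \<xi>) = E_closed hull x"
    using hull_diagonal_eq_covered_code[OF x(1) m x(2)] by blast
  have "A \<subseteq> E_closed hull x"
  proof (rule ccontr)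
    assume "\<not> A \<subseteq> E_closed hull x"
    then have "\<exists>a. a \<in> A - covered (m ` c \<xi>)" unfolding hull_x by blast
    then have missed: "missed \<xi> \<in> A - covered (m ` c \<xi>)" unfolding missed_def by (rule someI_ex)
    then have "missed \<xi> \<in> x" using \<xi> closed by simp
    then show False using missed hull_x hull_subset[of x E_closed] by auto
  qed
  then have "E_closed hull A = E_closed hull x"
    by (intro equalityI hull_mono[OF x(2)] hull_minimal[where S = E_closed] E_closed_hull)
  then obtain \<gamma> where "\<gamma> \<in> x" "index \<gamma> \<in> M - x"
    using diagonal_family_index_escapes[OF x(1)] unfolding index_def by auto
  then show False using closed \<open>M \<subseteq> A\<close> by auto
qed

subsection \<open>Stationarity\<close>

text \<open>
  The opponent moves \<open>G\<close> at the position \<open>b\<close>, and \<open>b'\<close> is a legal answer. The clause \<open>\<not> b' \<subseteq> G\<close>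
  ensures that the unbeaten positions have a union of size greater than \<open>\<mu>\<close>.
\<close>

definition legal :: "('a set \<Rightarrow> 'a set) \<Rightarrow> 'a set \<Rightarrow> 'a set \<Rightarrow> 'a set \<Rightarrow> 'a set \<Rightarrow> bool" where
  "legal F z b G b' \<longleftrightarrow> b \<in> P_less \<nu> L \<and> b' \<in> P_less \<nu> L \<and>
     b \<subseteq> b' \<and> G \<subseteq> covered b' \<and> \<not> b' \<subseteq> G \<and> fin_hull F (z \<union> b') \<inter> M \<subseteq> z"

lemma small_extension:
  assumes b: "b \<in> P_less \<nu> L" and G: "small G"
  shows "\<exists>b'\<in>P_less \<nu> L. b \<subseteq> b' \<and> G \<subseteq> covered b' \<and> \<not> b' \<subseteq> G"
proof -
  obtain a where a: "a \<in> P_less \<nu> L" "G \<subseteq> covered a" using small_subset_covered[OF G] by blast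
  have "\<not> L \<subseteq> G"
  proof
    assume "L \<subseteq> G"
    then have "|L| \<le>o \<mu>" using G ordLeq_transitive[OF card_of_mono1] unfolding small_def by blast
    then have "\<Lambda> \<le>o \<mu>"
      using ordIso_ordLeq_trans[OF ordIso_symmetric[OF card_of_Field_ordIso[OF Card_order_Lambda]]]
      by blast
    then show False using mu_less_Lambda not_ordLess_ordLeq by blast
  qed
  then obtain p where p: "p \<in> L" "p \<notin> G" by blast
  have "b \<union> a \<union> {p} \<in> P_less \<nu> L"
    using p by (intro nu.P_less_Un a b nu.finite_in_P_less[of "{p}"]) simp_all
  moreover have "G \<subseteq> covered (b \<union> a \<union> {p})" using a(2) covered_mono[of a "b \<union> a \<union> {p}"] by blast
  ultimately show ?thesis using p(2) by (intro bexI[of _ "b \<union> a \<union> {p}"]) auto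
qed

lemma unbeaten_in_P_less:
  assumes "unbeaten small (legal F z) b"
  shows "b \<in> P_less \<nu> L"
proof -
  have "small {}" using Card_order_empty[OF Card_order_mu] by (simp add: small_def)
  from unbeaten_reply[OF assms this] show ?thesis unfolding legal_def by blast
qed

lemma Union_unbeaten_not_small:
  assumes "unbeaten small (legal F z) b"
  shows "\<not> |\<Union>{b'. unbeaten small (legal F z) b'}| \<le>o \<mu>"
proof
  let ?W = "\<Union>{b'. unbeaten small (legal F z) b'}"
  assume "|?W| \<le>o \<mu>"
  moreover have "?W \<subseteq> L" using unbeaten_in_P_less unfolding P_less_def by blast
  ultimately have "small ?W" by (simp add: small_def)
  from unbeaten_reply[OF assms this] show False unfolding legal_def by blast
qed

definition settled :: "('a set \<Rightarrow> 'a set) \<Rightarrow> 'a set \<Rightarrow> 'a set \<Rightarrow> bool" where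
  "settled F z b \<longleftrightarrow> b \<in> P_less \<nu> L \<and> E_closed (covered b) \<and>
     fin_hull F (z \<union> b) \<subseteq> covered b \<and> fin_hull F (z \<union> b) \<inter> M \<subseteq> z"

lemma legal_play_limit:
  assumes play: "\<And>n. legal F z (\<beta> n) (G n) (\<beta> (Suc n))"
    and G: "\<And>n. fin_hull F (z \<union> \<beta> n) \<union> covered (\<beta> n) \<union> covered (covered (\<beta> n)) \<subseteq> G n"
  shows "settled F z (\<Union>n. \<beta> n)" and "covered (\<Union>n. \<beta> n) = (\<Union>n. G n)"
proof -
  let ?b = "\<Union>n. \<beta> n" and ?B = "\<Union>n. G n"
  have step: "\<beta> n \<subseteq> \<beta> (Suc n)" "G n \<subseteq> covered (\<beta> (Suc n))"
      "fin_hull F (z \<union> \<beta> (Suc n)) \<inter> M \<subseteq> z" "\<beta> n \<in> P_less \<nu> L" for n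
    using play[of n] unfolding legal_def by simp_all
  show covered_b: "covered ?b = ?B"
  proof
    show "covered ?b \<subseteq> ?B" using G unfolding covered_def by blast
    have "covered (\<beta> (Suc n)) \<subseteq> covered ?b" for n by (rule covered_mono) blast
    then show "?B \<subseteq> covered ?b" using step(2) by blast
  qed
  have "E_closed ?B"
    unfolding E_closed_def
  proof
    fix \<gamma> assume "\<gamma> \<in> ?B"
    then obtain n where "\<gamma> \<in> covered (\<beta> n)" using step(2) by blast
    then have "E \<gamma> \<subseteq> covered (covered (\<beta> n))" unfolding covered_def by blast
    then show "E \<gamma> \<subseteq> ?B" using G by blast
  qed
  moreover have "?b \<in> P_less \<nu> L" using step(4) by (intro nu.P_less_UN nu.nat_ordLess)
  moreover have hull: "fin_hull F (z \<union> ?b) = (\<Union>n. fin_hull F (z \<union> \<beta> n))"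
    using fin_hull_UN_incseq[of "\<lambda>n. z \<union> \<beta> n"] step(1) by (simp add: le_supI2)
  moreover have "fin_hull F (z \<union> ?b) \<subseteq> ?B" unfolding hull using G by blast
  moreover have "fin_hull F (z \<union> \<beta> n) \<subseteq> fin_hull F (z \<union> \<beta> (Suc n))" for n
    using step(1) by (intro fin_hull_mono) blast
  then have "fin_hull F (z \<union> ?b) \<inter> M \<subseteq> z" unfolding hull using step(3) by blast
  ultimately show "settled F z ?b" unfolding settled_def covered_b by simp
qed

context
  fixes F :: "'a set \<Rightarrow> 'a set"
  assumes fin_hull_P_kappa: "\<forall>y\<in>P_less \<kappa> L. fin_hull F y \<in> P_less \<kappa> L"
begin

lemma ex_hull_trace_subset:
  assumes b: "b \<in> P_less \<nu> L"
  shows "\<exists>z\<in>T. fin_hull F (z \<union> b) \<inter> M \<subseteq> z"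
proof -
  define K where "K s = fin_hull F (s \<union> b) \<inter> M" for s
  have "K s \<in> P_less \<kappa> M" if "s \<in> Fpow M" for s
  proof -
    have "s \<in> P_less \<kappa> L" using that mu_subset by (intro kappa.finite_in_P_less) (auto simp: Fpow_def)
    then have "fin_hull F (s \<union> b) \<in> P_less \<kappa> L"
      by (rule bspec[OF fin_hull_P_kappa kappa.P_less_Un[OF _ P_nu_imp_P_kappa[OF b]]])
    then show ?thesis unfolding K_def by (auto intro: P_less_in_subset P_less_subset)
  qed
  from kappa.stationary_meets_fin_hull_closed[where K = K, OF T_stationary this]
  obtain z where "z \<in> T" "fin_hull K z \<subseteq> z" by blast
  moreover have "fin_hull K z = fin_hull F (z \<union> b) \<inter> M"
    unfolding fin_hull_Un[of F z b] by (auto simp: K_def fin_hull_def)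
  ultimately show ?thesis by blast
qed

lemma ex_unbeaten_empty: "\<exists>z\<in>T. unbeaten small (legal F z) {}"
proof (rule ex_unbeaten_if_simultaneous_replies[where P = "\<lambda>b. b \<in> P_less \<nu> L" and Q = "(\<subseteq>)"
      and alive = "\<lambda>z b. fin_hull F (z \<union> b) \<inter> M \<subseteq> z"])
  show "{} \<in> P_less \<nu> L" by (intro nu.finite_in_P_less) simp_all
next
  fix b W and g :: "'a set \<Rightarrow> 'a set"
  assume b: "b \<in> P_less \<nu> L" and W: "W \<subseteq> T" and g: "\<forall>z\<in>W. small (g z)"
  have "|W| \<le>o \<mu>" using ordLeq_transitive[OF card_of_mono1[OF W] card_T] .
  then have "small (\<Union>z\<in>W. g z)" using g by (intro small_UN) simp_all
  from small_extension[OF b this]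
  obtain b' where "b' \<in> P_less \<nu> L" "b \<subseteq> b'" "(\<Union>z\<in>W. g z) \<subseteq> covered b'" "\<not> b' \<subseteq> (\<Union>z\<in>W. g z)"
    by (elim bexE conjE)
  then show "\<exists>b'. b' \<in> P_less \<nu> L \<and> b \<subseteq> b' \<and>
      (\<forall>z\<in>W. fin_hull F (z \<union> b') \<inter> M \<subseteq> z \<longrightarrow> legal F z b (g z) b')"
    using b unfolding legal_def by (intro exI[of _ b']) auto
next
  fix f :: "nat \<Rightarrow> 'a set"
  assume "\<forall>n. f n \<in> P_less \<nu> L \<and> f n \<subseteq> f (Suc n)"
  then have "(\<Union>n. f n) \<in> P_less \<nu> L" by (intro nu.P_less_UN nu.nat_ordLess) simp
  from ex_hull_trace_subset[OF this]
  obtain z where z: "z \<in> T" "fin_hull F (z \<union> (\<Union>n. f n)) \<inter> M \<subseteq> z" by blast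
  have "fin_hull F (z \<union> f n) \<subseteq> fin_hull F (z \<union> (\<Union>n. f n))" for n
    by (rule fin_hull_mono) blast
  with z show "\<exists>z\<in>T. \<forall>n. fin_hull F (z \<union> f n) \<inter> M \<subseteq> z" by blast
qed

lemma ex_settled_extensions_equal_covered:
  fixes I :: "'i set"
  assumes z: "z \<in> P_less \<kappa> M" and card_I: "|I| \<le>o \<mu>"
    and start: "\<forall>i\<in>I. unbeaten small (legal F z) (p i)"
  shows "\<exists>b B. \<forall>i\<in>I. p i \<subseteq> b i \<and> settled F z (b i) \<and> covered (b i) = B"
proof -
  define G where "G \<beta> = (\<Union>i\<in>I. fin_hull F (z \<union> \<beta> i) \<union> covered (\<beta> i) \<union> covered (covered (\<beta> i)))"
    for \<beta> :: "'i \<Rightarrow> 'a set"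
  have "small (G \<beta>)" if \<beta>: "\<forall>i\<in>I. unbeaten small (legal F z) (\<beta> i)" for \<beta>
    unfolding G_def
  proof (intro small_UN card_I small_Un small_covered)
    fix i assume "i \<in> I"
    then have b: "\<beta> i \<in> P_less \<kappa> L" using \<beta> P_nu_imp_P_kappa unbeaten_in_P_less by blast
    then show "small (\<beta> i)" "small (\<beta> i)" by (rule P_kappa_imp_small)+
    show "small (fin_hull F (z \<union> \<beta> i))"
      using P_less_mono[OF z mu_subset] b
      by (intro P_kappa_imp_small bspec[OF fin_hull_P_kappa] kappa.P_less_Un)
  qed
  with start have "\<exists>\<beta>. \<beta> 0 = p \<and> (\<forall>n. \<forall>i\<in>I. legal F z (\<beta> n i) (G (\<beta> n)) (\<beta> (Suc n) i))"
    by (intro interleaved_plays[where M = small])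
  then obtain \<beta> where \<beta>: "\<beta> 0 = p" "\<forall>n. \<forall>i\<in>I. legal F z (\<beta> n i) (G (\<beta> n)) (\<beta> (Suc n) i)"
    by blast
  have "settled F z (\<Union>n. \<beta> n i)" "covered (\<Union>n. \<beta> n i) = (\<Union>n. G (\<beta> n))" if "i \<in> I" for i
    by (rule legal_play_limit[where G = "\<lambda>n. G (\<beta> n)"]; use \<beta>(2) that in \<open>auto simp: G_def\<close>)+
  moreover have "p i \<subseteq> (\<Union>n. \<beta> n i)" for i
    using UN_upper[of 0 UNIV "\<lambda>n. \<beta> n i"] \<beta>(1) by simp
  ultimately show ?thesis by (intro exI[of _ "\<lambda>i. \<Union>n. \<beta> n i"] exI[of _ "\<Union>n. G (\<beta> n)"]) simp
qed

end

lemma ex_subset_card_kappa: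
  assumes "\<not> |W| \<le>o \<mu>"
  shows "\<exists>I\<subseteq>W. |I| =o \<kappa>"
proof -
  have "\<mu> \<le>o |W|"
    using assms ordLeq_total[of "|W|" \<mu>] Card_order_mu by (auto simp: card_order_on_def card_of_Well_order)
  then have "|Field \<kappa>| \<le>o |W|"
    using ordIso_ordLeq_trans[OF card_of_Field_ordIso[OF kappa.Card_order]]
      ordLeq_transitive[OF kappa_le_mu] by blast
  then obtain I where I: "I \<subseteq> W" "|Field \<kappa>| =o |I|"
    using internalize_card_of_ordLeq2[of "Field \<kappa>" W] by blast
  have "|I| =o \<kappa>"
    using ordIso_transitive[OF ordIso_symmetric[OF I(2)] card_of_Field_ordIso[OF kappa.Card_order]] .
  with I(1) show ?thesis by blast
qed

lemma settled_hull_in_diagonal_family: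
  assumes z: "z \<in> T" "z \<subseteq> M" and b: "settled F z b" and x: "fin_hull F (z \<union> b) \<in> P_less \<kappa> L"
    and sub: "z \<union> b \<subseteq> fin_hull F (z \<union> b)" and i: "i \<in> b" "i \<notin> enumeration (covered b) ` z"
  shows "fin_hull F (z \<union> b) \<in> diagonal_family"
proof -
  have "covered b = E_closed hull fin_hull F (z \<union> b)"
    using b sub unfolding settled_def by (intro covered_eq_hull) simp_all
  moreover have "fin_hull F (z \<union> b) \<inter> M = z" using z(2) b sub unfolding settled_def by blast
  moreover have "b \<in> P_less \<nu> (fin_hull F (z \<union> b))"
    using b sub P_less_in_subset unfolding settled_def by blast
  ultimately show ?thesis using z(1) x i sub unfolding diagonal_family_def by auto
qed

lemma diagonal_family_meets_club:
  assumes C: "club \<kappa> L C"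
  shows "diagonal_family \<inter> C \<noteq> {}"
proof -
  obtain F where F: "\<forall>y\<in>P_less \<kappa> L. fin_hull F y \<in> C \<and> y \<subseteq> fin_hull F y"
    using kappa.club_contains_fin_hulls[OF C] by (rule exE)
  then have F_P: "\<forall>y\<in>P_less \<kappa> L. fin_hull F y \<in> P_less \<kappa> L"
    using club_imp_P_less[OF C] by simp
  obtain z where z: "z \<in> T" "unbeaten small (legal F z) {}" using ex_unbeaten_empty[OF F_P] by blast
  have z_P: "z \<in> P_less \<kappa> M" using T_stationary z(1) unfolding stationary_def by blast
  obtain I where I: "I \<subseteq> \<Union>{b. unbeaten small (legal F z) b}" "|I| =o \<kappa>"
    using ex_subset_card_kappa[OF Union_unbeaten_not_small[OF z(2)]] by blast
  then have "\<forall>i\<in>I. \<exists>b. unbeaten small (legal F z) b \<and> i \<in> b" by blast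
  then obtain p where p: "\<forall>i\<in>I. unbeaten small (legal F z) (p i)" "\<forall>i\<in>I. i \<in> p i" by metis
  have "|I| \<le>o \<mu>" using ordIso_ordLeq_trans[OF I(2) kappa_le_mu] .
  from ex_settled_extensions_equal_covered[OF F_P z_P this p(1)]
  obtain b B where b: "\<forall>i\<in>I. p i \<subseteq> b i \<and> settled F z (b i) \<and> covered (b i) = B" by blast
  have "\<not> |I| <o \<kappa>" using I(2) not_ordLess_ordIso by blast
  then obtain i where i: "i \<in> I" "i \<notin> enumeration B ` z"
    using P_less_ex_not_in_image[OF z_P] by blast
  then have b_i: "settled F z (b i)" "i \<in> b i" "i \<notin> enumeration (covered (b i)) ` z"
    using bspec[OF b i(1)] bspec[OF p(2) i(1)] by auto
  have zb: "z \<union> b i \<in> P_less \<kappa> L"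
    using b_i(1) unfolding settled_def
    by (intro kappa.P_less_Un P_less_mono[OF z_P mu_subset] P_nu_imp_P_kappa) simp
  have x: "fin_hull F (z \<union> b i) \<in> C" "z \<union> b i \<subseteq> fin_hull F (z \<union> b i)"
      "fin_hull F (z \<union> b i) \<in> P_less \<kappa> L"
    using bspec[OF F zb] bspec[OF F_P zb] by blast+
  have "z \<subseteq> M" using z_P by (simp add: P_less_def)
  from settled_hull_in_diagonal_family[OF z(1) this b_i(1) x(3,2) b_i(2,3)] x(1)
  show ?thesis by blast
qed

lemma diagonal_family_nonreflecting_stationary: "nonreflecting_stationary \<kappa> \<mu> \<Lambda> diagonal_family"
proof -
  have "stationary \<kappa> L diagonal_family"
    unfolding stationary_def using diagonal_family_meets_club by (auto simp: diagonal_family_def)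
  then show ?thesis
    unfolding nonreflecting_stationary_def using diagonal_family_nonreflecting by simp
qed

end

theorem theorem3:
  fixes \<nu> :: "'n rel" and \<kappa> :: "'k rel" and \<mu> \<Lambda> :: "'a rel"
    and c :: "'a \<Rightarrow> 'a set" and T :: "'a set set"
  assumes "Card_order \<nu>" and "regularCard \<nu>" and "cardSuc natLeq \<le>o \<nu>"
    and "Card_order \<kappa>" and "regularCard \<kappa>" and "\<nu> <o \<kappa>"
    and "Card_order \<mu>" and "\<kappa> \<le>o \<mu>"
    and "Card_order \<Lambda>" and "\<mu> <o \<Lambda>" and "\<mu> initial_segment_of \<Lambda>"
    and "cov_eq \<Lambda> \<mu> \<nu>"
    and "\<forall>\<xi> \<in> Field \<mu>. c \<xi> \<in> P_less \<nu> (Field \<mu>)"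
    and "stationary \<kappa> (Field \<mu>) T" and "|T| =o \<mu>"
    and "\<forall>z \<in> T. unbounded_in \<nu> z {c \<xi> | \<xi>. \<xi> \<in> z}"
  shows "\<exists>S. nonreflecting_stationary \<kappa> \<mu> \<Lambda> S"
proof -
  obtain E where E: "\<And>\<alpha>. \<alpha> \<in> Field \<Lambda> \<Longrightarrow> E \<alpha> \<in> P_eq \<mu> (Field \<Lambda>)"
    and cov: "\<And>B. B \<in> P_eq \<mu> (Field \<Lambda>) \<Longrightarrow> \<exists>a\<in>P_less \<nu> (Field \<Lambda>). B \<subseteq> (\<Union>\<alpha>\<in>a. E \<alpha>)"
    using assms(12) unfolding cov_eq_def by blast
  have uncountable: "natLeq <o \<nu>"
    using ordLess_ordLeq_trans[OF cardSuc_greater[OF natLeq_Card_order] assms(3)] .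
  have subset: "Field \<mu> \<subseteq> Field \<Lambda>"
    using assms(11) unfolding init_seg_of_def Field_def by blast
  interpret covering_setting \<nu> \<kappa> \<mu> \<Lambda> c T E
  proof
    show "natLeq <o \<kappa>" using uncountable assms(6) by (rule ordLess_transitive)
    show "|T| \<le>o \<mu>" using assms(15) by (rule ordIso_imp_ordLeq)
  qed (use assms E cov subset uncountable in simp_all)
  show ?thesis using diagonal_family_nonreflecting_stationary by blast
qed

end
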